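(* Let $G$ be a graph endowed with a cell structure $X$ (an abstract cell complex on the vertex set of $G$ such that each edge of $G$ is contained in a cell) such that each cell of $X$ is gated in $G$ and the family of cells satisfies the 3-cell condition and the graded monotonicity condition. Then the thickening of the cells of $G$ (the graph on $V(G)$ in which two vertices are adjacent iff they belong to a common cell of $X$) is a clique-Helly graph, and each maximal clique of the thickening is (the vertex set of) a cell of $X$.
   Context: Graphs are connected, simple and locally finite, with path metric $d$, and $I(u,v)=\{x:d(u,x)+d(x,v)=d(u,v)\}$. A vertex subset $H$ is gated if for every vertex $x\notin H$ there is $x'\in H$ with $x'\in I(x,y)$ for all $y\in H$. A graph is clique-Helly if every family of pairwise intersecting maximal cliques has non-empty intersection. An abstract cell complex $X$ on $V$ is a family of finite subsets of $V$ (the cells), containing $\emptyset$, closed under intersections, with each vertex in finitely many cells. Faces of a cell $C$ are the cells contained in $C$; a facet of $C$ is a maximal proper face of $C$. The dimension $\dim(C)$ is the length of a longest chain of faces of $C$, normalized so that a simplex (all subsets being cells) with $d+1$ vertices has dimension $d$. 3-cell condition: for any three cells $C_1,C_2,C_3$ such that, for all $i\ne j$, $C_i\cap C_j$ is a facet of both $C_i$ and $C_j$, and $C_1\cap C_2\cap C_3$ is a facet of each of $C_1\cap C_2$, $C_1\cap C_3$, $C_2\cap C_3$, the union $C_1\cup C_2\cup C_3$ is contained in a common cell of $X$. Graded monotonicity condition: for any cell $C$ and any two intersecting faces $A,B$ of $C$ with $B\not\subseteq A$, there is a face $D$ of $C$ such that $A$ is a facet of $D$, $\dim(D)=\dim(A)+1$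 and $\dim(D\cap B)=\dim(A\cap B)+1$. *)

theory Defs
  imports Main
begin

text \<open>A graph is given by its vertex set \<open>V\<close> and its set \<open>E\<close> of two-element edges.\<close>

definition adj_rel :: "'a set set \<Rightarrow> ('a \<times> 'a) set" where
  "adj_rel E = {(u, v). {u, v} \<in> E}"

definition graph :: "'a set \<Rightarrow> 'a set set \<Rightarrow> bool" where
  "graph V E \<longleftrightarrow>
     V \<noteq> {} \<and>
     (\<forall>e\<in>E. e \<subseteq> V \<and> card e = 2) \<and>
     (\<forall>u\<in>V. \<forall>v\<in>V. (u, v) \<in> (adj_rel E)\<^sup>*) \<and>
     (\<forall>v\<in>V. finite {u. {u, v} \<in> E})"

text \<open>The path metric: \<open>(u, v) \<in> adj_rel E ^^ n\<close> says that there is a walk of length \<open>n\<close> from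
  \<open>u\<close> to \<open>v\<close>. The value is meaningful only for vertices joined by a walk.\<close>

definition gdist :: "'a set set \<Rightarrow> 'a \<Rightarrow> 'a \<Rightarrow> nat" where
  "gdist E u v = (LEAST n. (u, v) \<in> adj_rel E ^^ n)"

definition interval :: "'a set \<Rightarrow> 'a set set \<Rightarrow> 'a \<Rightarrow> 'a \<Rightarrow> 'a set" where
  "interval V E u v = {x \<in> V. gdist E u x + gdist E x v = gdist E u v}"

definition gated :: "'a set \<Rightarrow> 'a set set \<Rightarrow> 'a set \<Rightarrow> bool" where
  "gated V E H \<longleftrightarrow>
     H \<subseteq> V \<and> (\<forall>x \<in> V - H. \<exists>x'\<in>H. \<forall>y\<in>H. x' \<in> interval V E x y)"

definition clique :: "'a set \<Rightarrow> 'a set set \<Rightarrow> 'a set \<Rightarrow> bool" where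
  "clique V E K \<longleftrightarrow> K \<subseteq> V \<and> (\<forall>u\<in>K. \<forall>v\<in>K. u \<noteq> v \<longrightarrow> {u, v} \<in> E)"

definition maximal_clique :: "'a set \<Rightarrow> 'a set set \<Rightarrow> 'a set \<Rightarrow> bool" where
  "maximal_clique V E K \<longleftrightarrow>
     clique V E K \<and> (\<forall>K'. clique V E K' \<longrightarrow> K \<subseteq> K' \<longrightarrow> K' = K)"

text \<open>Families of maximal cliques may be infinite. The empty family is harmless, as its
  intersection \<open>\<Inter>{}\<close> is \<open>UNIV\<close>.\<close>

definition clique_helly :: "'a set \<Rightarrow> 'a set set \<Rightarrow> bool" where
  "clique_helly V E \<longleftrightarrow>
     graph V E \<and>
     (\<forall>F. (\<forall>K\<in>F. maximal_clique V E K) \<longrightarrow> pairwise (\<lambda>K L. K \<inter> L \<noteq> {}) F \<longrightarrow> \<Inter>F \<noteq> {})"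

text \<open>A cell complex on \<open>V\<close> is taken to cover \<open>V\<close>. When every edge of a connected graph on \<open>V\<close> lies
  in a cell, this is automatic unless the graph is a single vertex; there it only excludes
  the family consisting of the empty cell alone.\<close>

definition cell_complex :: "'a set \<Rightarrow> 'a set set \<Rightarrow> bool" where
  "cell_complex V X \<longleftrightarrow>
     (\<forall>C\<in>X. finite C) \<and> \<Union>X = V \<and>
     {} \<in> X \<and>
     (\<forall>C\<in>X. \<forall>D\<in>X. C \<inter> D \<in> X) \<and>
     (\<forall>v\<in>V. finite {C \<in> X. v \<in> C})"

definition cell_structure :: "'a set \<Rightarrow> 'a set set \<Rightarrow> 'a set set \<Rightarrow> bool" where
  "cell_structure V E X \<longleftrightarrow> cell_complex V X \<and> (\<forall>e\<in>E. \<exists>C\<in>X. e \<subseteq> C)"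

definition faces :: "'a set set \<Rightarrow> 'a set \<Rightarrow> 'a set set" where
  "faces X C = {F \<in> X. F \<subseteq> C}"

definition facet :: "'a set set \<Rightarrow> 'a set \<Rightarrow> 'a set \<Rightarrow> bool" where
  "facet X F C \<longleftrightarrow>
     F \<in> faces X C \<and> F \<subset> C \<and> \<not> (\<exists>F'\<in>faces X C. F \<subset> F' \<and> F' \<subset> C)"

text \<open>Chains of faces may contain both the empty cell and \<open>C\<close> itself. A simplex with \<open>d + 1\<close>
  vertices therefore has a longest chain with \<open>d + 2\<close> members, whence the shift by 2;
  the empty cell has dimension -1.\<close>

definition cell_dim :: "'a set set \<Rightarrow> 'a set \<Rightarrow> int" where
  "cell_dim X C = int (Max {card \<C> | \<C>. subset.chain (faces X C) \<C>}) - 2"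

definition three_cell_condition :: "'a set set \<Rightarrow> bool" where
  "three_cell_condition X \<longleftrightarrow>
     (\<forall>C1\<in>X. \<forall>C2\<in>X. \<forall>C3\<in>X.
        facet X (C1 \<inter> C2) C1 \<and> facet X (C1 \<inter> C2) C2 \<and>
        facet X (C1 \<inter> C3) C1 \<and> facet X (C1 \<inter> C3) C3 \<and>
        facet X (C2 \<inter> C3) C2 \<and> facet X (C2 \<inter> C3) C3 \<and>
        facet X (C1 \<inter> C2 \<inter> C3) (C1 \<inter> C2) \<and>
        facet X (C1 \<inter> C2 \<inter> C3) (C1 \<inter> C3) \<and>
        facet X (C1 \<inter> C2 \<inter> C3) (C2 \<inter> C3)
        \<longrightarrow> (\<exists>C\<in>X. C1 \<union> C2 \<union> C3 \<subseteq> C))"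

definition graded_monotonicity_condition :: "'a set set \<Rightarrow> bool" where
  "graded_monotonicity_condition X \<longleftrightarrow>
     (\<forall>C\<in>X. \<forall>A\<in>faces X C. \<forall>B\<in>faces X C.
        A \<inter> B \<noteq> {} \<and> \<not> B \<subseteq> A \<longrightarrow>
        (\<exists>D\<in>faces X C. facet X A D \<and> cell_dim X D = cell_dim X A + 1 \<and>
           cell_dim X (D \<inter> B) = cell_dim X (A \<inter> B) + 1))"

definition thickening :: "'a set set \<Rightarrow> 'a set set" where
  "thickening X = {{u, v} | u v. u \<noteq> v \<and> (\<exists>C\<in>X. u \<in> C \<and> v \<in> C)}"

end

theory Submission
  imports Defs
begin

text \<open>The cells have the Helly property and are conformal; the theorem combines the two.

  Helly: two vertices of a gated set have their whole interval inside that set. Hence, if three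
  gated sets meet pairwise, the gate in the third set of a vertex common to the first two lies in
  all three. Since cells are closed under intersection, this spreads from triples to all finite
  families of cells (\<open>finite_Helly\<close>), and by local finiteness a pairwise intersecting family of
  cells is finite.

  Conformal: every finite clique of the thickening lies in a cell. By Gilmore's criterion
  (\<open>finite_clique_subset_cell\<close>) it is enough that for any three cells some cell contains their
  three pairwise intersections. If two of the cells are disjoint, the third one does it. Otherwise
  the triple intersection \<open>Z\<close> is non-empty by the Helly property. Graded monotonicity, iterated,
  says that intersecting faces \<open>A\<close>, \<open>B\<close> of a cell lie in a common face of dimension
  \<open>dim A + dim B - dim (A \<inter> B)\<close> (\<open>modular_face\<close>). Call the sum of the three codimensions of \<open>Z\<close> in
  the pairwise intersections the defect. If each of these codimensions is 1, modularity cuts the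
  three cells down to faces which satisfy the premise of the 3-cell condition. If one of
  them exceeds 1, the triple is treated by two triples of smaller defect (\<open>defect_step\<close>).

  A maximal clique of the thickening is then contained in a cell, hence equal to it, and the Helly
  property of cells is the clique-Helly property.\<close>

section \<open>Gated sets\<close>

lemma sym_adj_rel: "sym (adj_rel E)"
  unfolding adj_rel_def sym_def by (auto simp: insert_commute)

lemma gdist_relpow:
  assumes "graph V E" "u \<in> V" "v \<in> V"
  shows "(u, v) \<in> adj_rel E ^^ gdist E u v"
proof -
  have "(u, v) \<in> (adj_rel E)\<^sup>*" using assms unfolding graph_def by blast
  then obtain n where "(u, v) \<in> adj_rel E ^^ n" using rtrancl_imp_relpow by blast
  then show ?thesis unfolding gdist_def by (rule LeastI)
qed

lemma gdist_le: "(u, v) \<in> adj_rel E ^^ n \<Longrightarrow> gdist E u v \<le> n"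
  unfolding gdist_def by (rule Least_le)

lemma relpow_sym:
  assumes "sym r" "(u, v) \<in> r ^^ n"
  shows "(v, u) \<in> r ^^ n"
  using assms(2)
proof (induction n arbitrary: v)
  case (Suc n)
  then obtain w where "(u, w) \<in> r ^^ n" "(w, v) \<in> r" by auto
  then have "(w, u) \<in> r ^^ n" "(v, w) \<in> r" using Suc.IH assms(1) by (auto dest: symD)
  then show ?case by (meson relpow_Suc_I2)
qed simp

lemma gdist_commute: "gdist E u v = gdist E v u"
proof -
  have "(u, v) \<in> adj_rel E ^^ n \<longleftrightarrow> (v, u) \<in> adj_rel E ^^ n" for n
    using relpow_sym[OF sym_adj_rel] by metis
  then show ?thesis unfolding gdist_def by simp
qed

lemma gdist_triangle:
  assumes "graph V E" "u \<in> V" "v \<in> V" "w \<in> V"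
  shows "gdist E u w \<le> gdist E u v + gdist E v w"
proof -
  have "(u, w) \<in> adj_rel E ^^ (gdist E u v + gdist E v w)"
    using gdist_relpow[OF assms(1)] assms(2-4) unfolding relpow_add by blast
  then show ?thesis by (rule gdist_le)
qed

lemma gdist_0_eq:
  assumes "graph V E" "u \<in> V" "v \<in> V" "gdist E u v = 0"
  shows "u = v"
  using gdist_relpow[OF assms(1-3)] assms(4) by simp

text \<open>The gate of a point of the interval lies on shortest paths from that point to both ends,
  so going to the gate and back costs nothing.\<close>

lemma gated_convex:
  assumes G: "graph V E" and H: "gated V E H" and u: "u \<in> H" and v: "v \<in> H"
    and x: "x \<in> interval V E u v"
  shows "x \<in> H"
proof (rule ccontr)
  assume "x \<notin> H"
  moreover have xV: "x \<in> V" and d: "gdist E u x + gdist E x v = gdist E u v"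
    using x unfolding interval_def by auto
  ultimately obtain g where g: "g \<in> H" "\<forall>y\<in>H. g \<in> interval V E x y"
    using H unfolding gated_def by blast
  have V: "g \<in> V" "u \<in> V" "v \<in> V" using H g(1) u v unfolding gated_def by auto
  have "gdist E x g + gdist E g u = gdist E x u" "gdist E x g + gdist E g v = gdist E x v"
    using g(2) u v unfolding interval_def by auto
  then have "gdist E x g = 0"
    using d gdist_triangle[OF G V(2,1,3)] gdist_commute[of E u x] gdist_commute[of E u g]
    by linarith
  then have "x = g" by (rule gdist_0_eq[OF G xV V(1)])
  with \<open>x \<notin> H\<close> g(1) show False by simp
qed

lemma gated_triple_Helly:
  assumes G: "graph V E" and g: "gated V E A" "gated V E B" "gated V E C"
    and ne: "A \<inter> B \<noteq> {}" "A \<inter> C \<noteq> {}" "B \<inter> C \<noteq> {}"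
  shows "A \<inter> B \<inter> C \<noteq> {}"
proof -
  obtain x y z where x: "x \<in> A" "x \<in> B" and y: "y \<in> A" "y \<in> C" and z: "z \<in> B" "z \<in> C"
    using ne by blast
  show ?thesis
  proof (cases "x \<in> C")
    case False
    have "x \<in> V" using x g unfolding gated_def by auto
    then obtain x' where x': "x' \<in> C" "\<forall>y\<in>C. x' \<in> interval V E x y"
      using False g(3) unfolding gated_def by blast
    have "x' \<in> A" using gated_convex[OF G g(1) x(1) y(1)] x' y by blast
    moreover have "x' \<in> B" using gated_convex[OF G g(2) x(2) z(1)] x' z by blast
    ultimately show ?thesis using x' by blast
  qed (use x in blast)
qed

section \<open>The Helly property of intersection-closed families\<close>

text \<open>Intersecting all members with a fixed member \<open>A\<close> gives a smaller family
  whose members still meet pairwise, by the triple condition.\<close>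

lemma finite_Helly:
  assumes Int: "\<And>A B. A \<in> X \<Longrightarrow> B \<in> X \<Longrightarrow> A \<inter> B \<in> X"
    and triple: "\<And>A B C. A \<in> X \<Longrightarrow> B \<in> X \<Longrightarrow> C \<in> X \<Longrightarrow>
      A \<inter> B \<noteq> {} \<Longrightarrow> A \<inter> C \<noteq> {} \<Longrightarrow> B \<inter> C \<noteq> {} \<Longrightarrow> A \<inter> B \<inter> C \<noteq> {}"
    and "finite F" "F \<noteq> {}" "F \<subseteq> X" "\<And>A B. A \<in> F \<Longrightarrow> B \<in> F \<Longrightarrow> A \<inter> B \<noteq> {}"
  shows "\<Inter>F \<noteq> {}"
  using assms(3-6)
proof (induction "card F" arbitrary: F rule: less_induct)
  case less
  obtain A where A: "A \<in> F" using less.prems by blast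
  show ?case
  proof (cases "F = {A}")
    case True
    then show ?thesis using less.prems(4)[OF A A] by simp
  next
    case False
    define F' where "F' = (\<inter>) A ` (F - {A})"
    have "card F' \<le> card (F - {A})"
      unfolding F'_def using less.prems by (intro card_image_le) auto
    also have "\<dots> < card F" using A less.prems(1) by (intro psubset_card_mono) auto
    finally have "card F' < card F" .
    moreover have "finite F'" unfolding F'_def using less.prems(1) by simp
    moreover have "F' \<noteq> {}" unfolding F'_def using A False by blast
    moreover have "F' \<subseteq> X" unfolding F'_def using less.prems(3) A Int by blast
    moreover have "B \<inter> C \<noteq> {}" if BC: "B \<in> F'" "C \<in> F'" for B C
    proof -
      obtain B' C' where b: "B' \<in> F" "B = A \<inter> B'" and c: "C' \<in> F" "C = A \<inter> C'"
        using BC unfolding F'_def by blast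
      have "A \<inter> B' \<inter> C' \<noteq> {}" using less.prems A b(1) c(1) by (intro triple) auto
      then show ?thesis using b(2) c(2) by blast
    qed
    ultimately have "\<Inter>F' \<noteq> {}" by (rule less.hyps)
    moreover obtain B where "B \<in> F" "B \<noteq> A" using A False by blast
    then have "\<Inter>F' \<subseteq> \<Inter>F" unfolding F'_def by blast
    ultimately show ?thesis by blast
  qed
qed

section \<open>Modularity of the dimension\<close>

locale graded_cells =
  fixes X :: "'a set set"
  assumes finite_cell: "C \<in> X \<Longrightarrow> finite C"
    and Int_cell: "A \<in> X \<Longrightarrow> B \<in> X \<Longrightarrow> A \<inter> B \<in> X"
    and graded: "graded_monotonicity_condition X"
begin

abbreviation dim :: "'a set \<Rightarrow> int" where
  "dim \<equiv> cell_dim X"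

lemma dim_strict_mono:
  assumes "A \<in> X" "B \<in> X" "A \<subset> B"
  shows "dim A < dim B"
proof -
  let ?L = "\<lambda>C. {card \<C> | \<C>. subset.chain (faces X C) \<C>}"
  have fin: "finite (faces X C)" if "C \<in> X" for C
    using finite_cell[OF that] unfolding faces_def by (auto intro: finite_subset[of _ "Pow C"])
  have finL: "finite (?L C)" if "C \<in> X" for C
  proof -
    have "?L C \<subseteq> card ` Pow (faces X C)" unfolding subset.chain_def by auto
    then show ?thesis using fin[OF that] by (meson finite_Pow_iff finite_imageI finite_subset)
  qed
  have "0 \<in> ?L A" by (auto intro!: exI[of _ "{}"])
  then have "Max (?L A) \<in> ?L A" using Max_in[OF finL[OF assms(1)]] by blast
  then obtain \<C> where C: "subset.chain (faces X A) \<C>" "card \<C> = Max (?L A)" by auto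
  have sub: "\<C> \<subseteq> faces X A" using C(1) unfolding subset.chain_def by blast
  \<comment> \<open>A longest chain of faces of the smaller cell is prolonged by the larger one.\<close>
  have "subset.chain (faces X B) (insert B \<C>)"
    using C(1) sub assms unfolding subset.chain_def faces_def by blast
  then have "card (insert B \<C>) \<in> ?L B" by blast
  then have "card (insert B \<C>) \<le> Max (?L B)" using Max_ge[OF finL[OF assms(2)]] by blast
  moreover have "B \<notin> \<C>" using sub assms(3) unfolding faces_def by blast
  moreover have "finite \<C>" using sub fin[OF assms(1)] finite_subset by blast
  ultimately show ?thesis unfolding cell_dim_def using C(2) by simp
qed

lemma dim_mono: "A \<in> X \<Longrightarrow> B \<in> X \<Longrightarrow> A \<subseteq> B \<Longrightarrow> dim A \<le> dim B"
  using dim_strict_mono[of A B] by (cases "A = B") (simp_all add: psubset_eq)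

lemma facet_if_dim:
  assumes "A \<in> X" "B \<in> X" "A \<subseteq> B" "dim B = dim A + 1"
  shows "facet X A B"
proof -
  have False if "F \<in> X" "A \<subset> F" "F \<subset> B" for F
    using dim_strict_mono[of A F] dim_strict_mono[of F B] that assms by simp
  moreover have "A \<noteq> B" using assms(4) by auto
  ultimately show ?thesis using assms unfolding facet_def faces_def by blast
qed

text \<open>One application of graded monotonicity enlarges \<open>A\<close> and \<open>A \<inter> B\<close> by one dimension each;
  it is repeated until \<open>B\<close> is swallowed.\<close>

lemma modular_face:
  assumes "C \<in> X" "A \<in> X" "B \<in> X" "A \<subseteq> C" "B \<subseteq> C" "A \<inter> B \<noteq> {}"
  shows "\<exists>D\<in>X. A \<union> B \<subseteq> D \<and> D \<subseteq> C \<and> dim D = dim A + dim B - dim (A \<inter> B)"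
  using assms
proof (induction "nat (dim B - dim (A \<inter> B))" arbitrary: A rule: less_induct)
  case less
  show ?case
  proof (cases "B \<subseteq> A")
    case True
    then have "A \<inter> B = B" by blast
    then show ?thesis using less.prems True by (intro bexI[of _ A]) auto
  next
    case False
    obtain A' where A': "A' \<in> faces X C" "facet X A A'" "dim A' = dim A + 1"
        "dim (A' \<inter> B) = dim (A \<inter> B) + 1"
      using graded[unfolded graded_monotonicity_condition_def, rule_format, of C A B]
        less.prems False unfolding faces_def by auto
    have sub: "A' \<in> X" "A' \<subseteq> C" "A \<subseteq> A'" using A'(1,2) unfolding facet_def faces_def by auto
    have "dim (A' \<inter> B) \<le> dim B" using dim_mono Int_cell less.prems sub(1) by simp
    then have "nat (dim B - dim (A' \<inter> B)) < nat (dim B - dim (A \<inter> B))" using A'(4) by simp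
    moreover have "A' \<inter> B \<noteq> {}" using sub(3) less.prems by blast
    ultimately obtain D where "D \<in> X" "A' \<union> B \<subseteq> D" "D \<subseteq> C"
        "dim D = dim A' + dim B - dim (A' \<inter> B)"
      using less.hyps[of A'] less.prems sub by blast
    then show ?thesis using A' sub(3) by (intro bexI[of _ D]) auto
  qed
qed

corollary dim_submodular:
  assumes "C \<in> X" "A \<in> X" "B \<in> X" "A \<subseteq> C" "B \<subseteq> C" "A \<inter> B \<noteq> {}"
  shows "dim A + dim B \<le> dim C + dim (A \<inter> B)"
proof -
  obtain D where "D \<in> X" "D \<subseteq> C" "dim D = dim A + dim B - dim (A \<inter> B)"
    using modular_face[OF assms] by blast
  then show ?thesis using dim_mono[of D C] assms(1) by simp
qed

section \<open>Three cells with a common vertex\<close>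

definition defect :: "'a set \<Rightarrow> 'a set \<Rightarrow> 'a set \<Rightarrow> int" where
  "defect A B C = dim (A \<inter> B) + dim (A \<inter> C) + dim (B \<inter> C) - 3 * dim (A \<inter> B \<inter> C)"

definition joined :: "'a set \<Rightarrow> 'a set \<Rightarrow> 'a set \<Rightarrow> bool" where
  "joined A B C \<longleftrightarrow> (\<exists>D\<in>X. A \<inter> B \<union> A \<inter> C \<union> B \<inter> C \<subseteq> D)"

lemma defect_rotate: "defect A B C = defect B C A"
  unfolding defect_def by (simp add: Int_ac)

lemma joined_rotate: "joined A B C \<longleftrightarrow> joined B C A"
  unfolding joined_def by (simp add: Int_ac Un_ac)

text \<open>The base case. The faces of dimension \<open>dim Z + 2\<close> spanned by two pairwise intersections
  satisfy the premise of the 3-cell condition.\<close>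

lemma joined_if_codims_1:
  assumes three: "three_cell_condition X"
    and X: "A \<in> X" "B \<in> X" "C \<in> X" and ne: "A \<inter> B \<inter> C \<noteq> {}"
    and d: "dim (A \<inter> B) = dim (A \<inter> B \<inter> C) + 1" "dim (A \<inter> C) = dim (A \<inter> B \<inter> C) + 1"
      "dim (B \<inter> C) = dim (A \<inter> B \<inter> C) + 1"
  shows "joined A B C"
proof -
  let ?Z = "A \<inter> B \<inter> C"
  have Z: "A \<inter> B \<inter> (A \<inter> C) = ?Z" "A \<inter> B \<inter> (B \<inter> C) = ?Z" "A \<inter> C \<inter> (B \<inter> C) = ?Z" by blast+
  obtain P where P: "P \<in> X" "A \<inter> B \<union> A \<inter> C \<subseteq> P" "P \<subseteq> A" "dim P = dim ?Z + 2"
    using modular_face[of A "A \<inter> B" "A \<inter> C"] X ne d Int_cell by (auto simp: Z)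
  obtain Q where Q: "Q \<in> X" "A \<inter> B \<union> B \<inter> C \<subseteq> Q" "Q \<subseteq> B" "dim Q = dim ?Z + 2"
    using modular_face[of B "A \<inter> B" "B \<inter> C"] X ne d Int_cell by (auto simp: Z)
  obtain R where R: "R \<in> X" "A \<inter> C \<union> B \<inter> C \<subseteq> R" "R \<subseteq> C" "dim R = dim ?Z + 2"
    using modular_face[of C "A \<inter> C" "B \<inter> C"] X ne d Int_cell by (auto simp: Z)
  have eq: "P \<inter> Q = A \<inter> B" "P \<inter> R = A \<inter> C" "Q \<inter> R = B \<inter> C" "P \<inter> Q \<inter> R = ?Z"
    using P(2,3) Q(2,3) R(2,3) by blast+
  have "facet X (P \<inter> Q) P" "facet X (P \<inter> Q) Q" "facet X (P \<inter> R) P" "facet X (P \<inter> R) R"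
      "facet X (Q \<inter> R) Q" "facet X (Q \<inter> R) R"
    by (rule facet_if_dim; use P Q R X d eq Int_cell in simp)+
  moreover have "facet X (P \<inter> Q \<inter> R) (P \<inter> Q)" "facet X (P \<inter> Q \<inter> R) (P \<inter> R)"
      "facet X (P \<inter> Q \<inter> R) (Q \<inter> R)"
    unfolding eq(4) unfolding eq by (rule facet_if_dim; use X d Int_cell in auto)+
  ultimately obtain D where "D \<in> X" "P \<union> Q \<union> R \<subseteq> D"
    using three P(1) Q(1) R(1) unfolding three_cell_condition_def by blast
  then show ?thesis unfolding joined_def using P(2) Q(2) by blast
qed

text \<open>The inductive step. Graded monotonicity gives a face \<open>A'\<close> of \<open>A\<close> that contains \<open>A \<inter> C\<close> and
  meets \<open>B\<close> in dimension \<open>dim Z + 1\<close>. The triple \<open>A'\<close>, \<open>B\<close>, \<open>C\<close> has smaller defect, since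
  \<open>A \<inter> B\<close> has been shrunk; let \<open>D\<close> be a cell for it. In a second step, \<open>D\<close> replaces \<open>C\<close>, while
  \<open>A\<close> and \<open>B\<close> are replaced by faces \<open>P\<close>, \<open>Q\<close> of modular dimension. By submodularity, the
  codimensions of the new triple intersection in \<open>P \<inter> D\<close> and \<open>Q \<inter> D\<close> are at most the old ones,
  while its codimension in \<open>A \<inter> B\<close> has dropped.\<close>

lemma defect_step:
  assumes X: "A \<in> X" "B \<in> X" "C \<in> X" and ne: "A \<inter> B \<inter> C \<noteq> {}"
    and codim: "dim (A \<inter> B) > dim (A \<inter> B \<inter> C) + 1"
    and IH: "\<And>P Q R. P \<in> X \<Longrightarrow> Q \<in> X \<Longrightarrow> R \<in> X \<Longrightarrow> P \<inter> Q \<inter> R \<noteq> {} \<Longrightarrow>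
      defect P Q R < defect A B C \<Longrightarrow> joined P Q R"
  shows "joined A B C"
proof -
  let ?Z = "A \<inter> B \<inter> C"
  have Z: "A \<inter> C \<inter> (A \<inter> B) = ?Z" "A \<inter> B \<inter> (A \<inter> C) = ?Z" "A \<inter> B \<inter> (B \<inter> C) = ?Z" by blast+
  have "\<not> A \<inter> B \<subseteq> A \<inter> C" using codim by (metis Z(2) inf.orderE less_add_one not_less_iff_gr_or_eq)
  then obtain A' where A': "A' \<in> faces X A" "facet X (A \<inter> C) A'" "dim (A' \<inter> (A \<inter> B)) = dim ?Z + 1"
    using graded[unfolded graded_monotonicity_condition_def, rule_format, of A "A \<inter> C" "A \<inter> B"]
      X ne Int_cell unfolding faces_def Z by auto
  have sub: "A' \<in> X" "A' \<subseteq> A" "A \<inter> C \<subseteq> A'" using A'(1,2) unfolding facet_def faces_def by auto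
  have eq: "A' \<inter> C = A \<inter> C" "A' \<inter> B \<inter> C = ?Z" "A' \<inter> (A \<inter> B) = A' \<inter> B" using sub by blast+
  have "defect A' B C < defect A B C" unfolding defect_def eq using A'(3) eq codim by simp
  then have "joined A' B C" using IH X sub ne eq by simp
  then obtain D where D: "D \<in> X" "A' \<inter> B \<union> A \<inter> C \<union> B \<inter> C \<subseteq> D" unfolding joined_def eq by blast
  obtain P where P: "P \<in> X" "A \<inter> B \<union> A \<inter> C \<subseteq> P" "P \<subseteq> A"
      "dim P = dim (A \<inter> B) + dim (A \<inter> C) - dim ?Z"
    using modular_face[of A "A \<inter> B" "A \<inter> C"] X ne Int_cell by (auto simp: Z)
  obtain Q where Q: "Q \<in> X" "A \<inter> B \<union> B \<inter> C \<subseteq> Q" "Q \<subseteq> B"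
      "dim Q = dim (A \<inter> B) + dim (B \<inter> C) - dim ?Z"
    using modular_face[of B "A \<inter> B" "B \<inter> C"] X ne Int_cell by (auto simp: Z)
  have PQ: "P \<inter> Q = A \<inter> B" "P \<inter> D \<inter> (A \<inter> B) = A \<inter> B \<inter> D" "Q \<inter> D \<inter> (A \<inter> B) = A \<inter> B \<inter> D"
    using P(2,3) Q(2,3) by blast+
  have neD: "A \<inter> B \<inter> D \<noteq> {}" using ne D(2) by blast
  have "dim ?Z + 1 \<le> dim (A \<inter> B \<inter> D)"
    using dim_mono[of "A' \<inter> B" "A \<inter> B \<inter> D"] A'(3) eq D sub X Int_cell by auto
  moreover have "dim (P \<inter> D) + dim (A \<inter> B) \<le> dim P + dim (A \<inter> B \<inter> D)"
    using dim_submodular[of P "P \<inter> D" "A \<inter> B"] P D X Int_cell neD PQ by auto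
  moreover have "dim (Q \<inter> D) + dim (A \<inter> B) \<le> dim Q + dim (A \<inter> B \<inter> D)"
    using dim_submodular[of Q "Q \<inter> D" "A \<inter> B"] Q D X Int_cell neD PQ by auto
  ultimately have "defect P Q D < defect A B C"
    unfolding defect_def PQ(1) using P(4) Q(4) by simp
  then have "joined P Q D" using IH P(1) Q(1) D(1) neD PQ(1) by simp
  then obtain J where "J \<in> X" "A \<inter> B \<union> P \<inter> D \<union> Q \<inter> D \<subseteq> J" unfolding joined_def PQ(1) by blast
  moreover have "A \<inter> C \<subseteq> P \<inter> D" "B \<inter> C \<subseteq> Q \<inter> D" using P(2) Q(2) D(2) by blast+
  ultimately show ?thesis unfolding joined_def by blast
qed

lemma joined_if_common_vertex:
  assumes three: "three_cell_condition X"
    and "A \<in> X" "B \<in> X" "C \<in> X" "A \<inter> B \<inter> C \<noteq> {}"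
  shows "joined A B C"
  using assms(2-5)
proof (induction "nat (defect A B C)" arbitrary: A B C rule: less_induct)
  case less
  let ?Z = "A \<inter> B \<inter> C"
  note X = less.prems(1-3)
  show ?case
  proof (cases "A \<inter> B \<subseteq> C \<or> A \<inter> C \<subseteq> B \<or> B \<inter> C \<subseteq> A")
    case True
    \<comment> \<open>One pairwise intersection lies in the third cell, which contains the other two anyway.\<close>
    then show ?thesis unfolding joined_def using X by blast
  next
    case False
    then have "?Z \<subset> A \<inter> B" "?Z \<subset> A \<inter> C" "?Z \<subset> B \<inter> C" by blast+
    then have gt: "dim ?Z < dim (A \<inter> B)" "dim ?Z < dim (A \<inter> C)" "dim ?Z < dim (B \<inter> C)"
      using X by (auto intro!: dim_strict_mono Int_cell)
    then have "defect A B C > 0" unfolding defect_def by simp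
    then have IH: "joined P Q R"
      if "P \<in> X" "Q \<in> X" "R \<in> X" "P \<inter> Q \<inter> R \<noteq> {}" "defect P Q R < defect A B C" for P Q R
      using less.hyps[of P Q R] that by simp
    have rot: "defect B C A = defect A B C" "defect C A B = defect A B C"
      using defect_rotate[of A B C] defect_rotate[of C A B] by auto
    consider "dim (A \<inter> B) > dim ?Z + 1" | "dim (A \<inter> C) > dim ?Z + 1" | "dim (B \<inter> C) > dim ?Z + 1"
      | "dim (A \<inter> B) = dim ?Z + 1" "dim (A \<inter> C) = dim ?Z + 1" "dim (B \<inter> C) = dim ?Z + 1"
      using gt by linarith
    then show ?thesis
    proof cases
      case 1
      then show ?thesis using defect_step[OF less.prems] IH by blast
    next
      case 2
      have "joined C A B"
        by (rule defect_step) (use 2 less.prems IH in \<open>simp_all add: rot Int_ac\<close>)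
      then show ?thesis using joined_rotate by blast
    next
      case 3
      have "joined B C A"
        by (rule defect_step) (use 3 less.prems IH in \<open>simp_all add: rot Int_ac\<close>)
      then show ?thesis using joined_rotate by blast
    next
      case 4
      then show ?thesis using joined_if_codims_1[OF three less.prems] by blast
    qed
  qed
qed

end

section \<open>Conformality\<close>

text \<open>Gilmore's criterion. For three elements of the clique, removing each one in turn leaves three
  smaller cliques, and every element of the clique belongs to at least two of them.\<close>

lemma finite_clique_subset_cell:
  assumes "{} \<in> X"
    and pairs: "\<And>u v. u \<in> K \<Longrightarrow> v \<in> K \<Longrightarrow> \<exists>C\<in>X. u \<in> C \<and> v \<in> C"
    and triple: "\<And>A B C. A \<in> X \<Longrightarrow> B \<in> X \<Longrightarrow> C \<in> X \<Longrightarrow> \<exists>D\<in>X. A \<inter> B \<union> A \<inter> C \<union> B \<inter> C \<subseteq> D"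
    and "finite K"
  shows "\<exists>C\<in>X. K \<subseteq> C"
  using \<open>finite K\<close> pairs
proof (induction K rule: finite_psubset_induct)
  case (psubset K)
  show ?case
  proof (cases "\<exists>u v. K \<subseteq> {u, v}")
    case True
    show ?thesis
    proof (cases "K = {}")
      case False
      then obtain u v where "K = {u, v}" using True by (metis subset_insert_iff subset_singletonD
        insert_absorb2 insert_Diff)
      then show ?thesis using psubset.prems[of u v] by auto
    qed (use \<open>{} \<in> X\<close> in blast)
  next
    case False
    then obtain x y z where xyz: "x \<in> K" "y \<in> K" "z \<in> K" "x \<noteq> y" "x \<noteq> z" "y \<noteq> z" by blast
    have IH: "\<exists>C\<in>X. K - {w} \<subseteq> C" if "w \<in> K" for w
      using that psubset.prems by (intro psubset.IH) auto
    obtain A B C where c: "A \<in> X" "K - {x} \<subseteq> A" "B \<in> X" "K - {y} \<subseteq> B" "C \<in> X" "K - {z} \<subseteq> C"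
      using IH xyz(1-3) by meson
    have "K \<subseteq> A \<inter> B \<union> A \<inter> C \<union> B \<inter> C" using c(2,4,6) xyz(4-6) by blast
    then show ?thesis using triple[OF c(1,3,5)] by blast
  qed
qed

section \<open>The thickening\<close>

lemma cell_clique:
  "\<Union>X = V \<Longrightarrow> C \<in> X \<Longrightarrow> clique V (thickening X) C"
  unfolding clique_def thickening_def by blast

lemma thickening_neighbour:
  "{u, v} \<in> thickening X \<Longrightarrow> \<exists>C\<in>X. u \<in> C \<and> v \<in> C"
  unfolding thickening_def by (auto simp: doubleton_eq_iff)

lemma finite_cell_star:
  assumes "cell_complex V X" "v \<in> V"
  shows "finite (\<Union>{C \<in> X. v \<in> C})"
  using assms unfolding cell_complex_def by auto

lemma graph_thickening:
  assumes G: "graph V E" and S: "cell_structure V E X"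
  shows "graph V (thickening X)"
proof -
  have cc: "cell_complex V X" using S unfolding cell_structure_def by blast
  then have U: "\<Union>X = V" unfolding cell_complex_def by blast
  have "E \<subseteq> thickening X"
  proof
    fix e assume e: "e \<in> E"
    then have "card e = 2" using G unfolding graph_def by blast
    then obtain u v where "e = {u, v}" "u \<noteq> v" by (auto simp: card_2_iff)
    moreover obtain C where "C \<in> X" "e \<subseteq> C" using S e unfolding cell_structure_def by blast
    ultimately show "e \<in> thickening X" unfolding thickening_def by blast
  qed
  then have "(adj_rel E)\<^sup>* \<subseteq> (adj_rel (thickening X))\<^sup>*"
    by (intro rtrancl_mono) (auto simp: adj_rel_def)
  moreover have "finite {u. {u, v} \<in> thickening X}" if "v \<in> V" for v
  proof (rule finite_subset[OF _ finite_cell_star[OF cc that]])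
    show "{u. {u, v} \<in> thickening X} \<subseteq> \<Union>{C \<in> X. v \<in> C}"
      using thickening_neighbour by fastforce
  qed
  moreover have "e \<subseteq> V \<and> card e = 2" if "e \<in> thickening X" for e
    using that U unfolding thickening_def by auto
  ultimately show ?thesis using G unfolding graph_def by blast
qed

theorem proposition1p7:
  fixes V :: "'a set" and E X :: "'a set set"
  assumes "graph V E"
    and "cell_structure V E X"
    and "\<And>C. C \<in> X \<Longrightarrow> C \<noteq> {} \<Longrightarrow> gated V E C"
    and "three_cell_condition X"
    and "graded_monotonicity_condition X"
  shows "clique_helly V (thickening X) \<and>
         (\<forall>K. maximal_clique V (thickening X) K \<longrightarrow> K \<in> X)"
proof -
  have cc: "cell_complex V X" using assms(2) unfolding cell_structure_def by blast
  then have fin: "\<And>C. C \<in> X \<Longrightarrow> finite C" and U: "\<Union>X = V" and empty: "{} \<in> X"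
    and Int: "\<And>C D. C \<in> X \<Longrightarrow> D \<in> X \<Longrightarrow> C \<inter> D \<in> X"
    and star: "\<And>v. v \<in> V \<Longrightarrow> finite {C \<in> X. v \<in> C}"
    unfolding cell_complex_def by auto
  interpret graded_cells X using fin Int assms(5) by unfold_locales
  have common: "A \<inter> B \<inter> C \<noteq> {}"
    if "A \<in> X" "B \<in> X" "C \<in> X" "A \<inter> B \<noteq> {}" "A \<inter> C \<noteq> {}" "B \<inter> C \<noteq> {}" for A B C
    using that assms(1,3) by (intro gated_triple_Helly) auto
  have Gilmore: "\<exists>D\<in>X. A \<inter> B \<union> A \<inter> C \<union> B \<inter> C \<subseteq> D" if X: "A \<in> X" "B \<in> X" "C \<in> X" for A B C
  proof (cases "A \<inter> B = {} \<or> A \<inter> C = {} \<or> B \<inter> C = {}")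
    case True
    then show ?thesis using X by blast
  next
    case False
    then have "A \<inter> B \<inter> C \<noteq> {}" using common X by blast
    then show ?thesis using joined_if_common_vertex[OF assms(4) X] unfolding joined_def by blast
  qed
  have max: "K \<in> X \<and> K \<noteq> {}" if K: "maximal_clique V (thickening X) K" for K
  proof -
    have cl: "clique V (thickening X) K"
      and mx: "\<And>K'. clique V (thickening X) K' \<Longrightarrow> K \<subseteq> K' \<Longrightarrow> K' = K"
      using K unfolding maximal_clique_def by blast+
    have KV: "K \<subseteq> V" using cl unfolding clique_def by blast
    obtain v0 where "v0 \<in> V" using assms(1) unfolding graph_def by blast
    then have "clique V (thickening X) {v0}" unfolding clique_def by simp
    then have ne: "K \<noteq> {}" using mx[of "{v0}"] by blast
    have pairs: "\<exists>C\<in>X. u \<in> C \<and> v \<in> C" if "u \<in> K" "v \<in> K" for u v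
    proof (cases "u = v")
      case True
      then show ?thesis using that KV U by blast
    next
      case False
      then show ?thesis using that cl thickening_neighbour unfolding clique_def by metis
    qed
    obtain v where v: "v \<in> K" using ne by blast
    have "K \<subseteq> \<Union>{C \<in> X. v \<in> C}" using pairs v by blast
    then have "finite K" using finite_cell_star[OF cc] v KV by (meson finite_subset subsetD)
    then obtain C where C: "C \<in> X" "K \<subseteq> C"
      using finite_clique_subset_cell[OF empty pairs Gilmore] by blast
    then have "C = K" using mx cell_clique[OF U] by blast
    then show ?thesis using C ne by blast
  qed
  have "\<Inter>F \<noteq> {}"
    if F: "\<forall>K\<in>F. maximal_clique V (thickening X) K" and pw: "pairwise (\<lambda>K L. K \<inter> L \<noteq> {}) F" for F
  proof (cases "F = {}")
    case False
    then obtain K where K: "K \<in> F" by blast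
    have FX: "F \<subseteq> X" and ne: "\<And>K. K \<in> F \<Longrightarrow> K \<noteq> {}" using F max by auto
    have meet: "A \<inter> B \<noteq> {}" if "A \<in> F" "B \<in> F" for A B
      using that pw ne unfolding pairwise_def by (cases "A = B") auto
    \<comment> \<open>All members of the family meet one finite cell, so the family is finite.\<close>
    have "F \<subseteq> (\<Union>v\<in>K. {C \<in> X. v \<in> C})" using meet[OF K] FX by blast
    moreover have "finite (\<Union>v\<in>K. {C \<in> X. v \<in> C})"
      using K FX fin star U by (intro finite_UN_I) auto
    ultimately have "finite F" by (rule finite_subset)
    then show ?thesis using finite_Helly[of X F] Int common False FX meet by blast
  qed simp
  then show ?thesis
    unfolding clique_helly_def using graph_thickening[OF assms(1,2)] max by blast
qed

end
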